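(* For $q\in\mathbb{C}$ with $|q|<1$, $$\sum_{i,j\ge0}\frac{q^{2i^2-2ij+j^2-i+j}}{(q;q)_{2i}(q;q)_{j}}=\frac{1}{(q;q^2)_{\infty}^2 (q^{2};q^{4})_{\infty}},\qquad \sum_{i,j\ge0}\frac{q^{2i^2-2ij+j^2+i}}{(q;q)_{2i+1}(q;q)_{j}}=\frac{1}{(q;q^2)_{\infty}^2 (q^{2};q^{4})_{\infty}},$$ $$\sum_{i,j\geq 0} \frac{q^{2i^2-2ij+j^2-3i+2j}}{(q;q)_{2i}(q;q)_j} = q^{-1}\frac{(q^{2};q^{4})_{\infty}}{(q;q^2)_{\infty}^3},\qquad \sum_{i,j\ge0}\frac{q^{2i^2-2ij+j^2-i+j}}{(q;q)_{2i+1}(q;q)_{j}}=\frac{(q^{2};q^{4})_{\infty}}{(q;q^2)_{\infty}^3}.$$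
   Context: For $|q|<1$: $(a;q)_\infty=\prod_{k\ge0}(1-aq^k)$ and, for integers $n\ge0$, $(a;q)_n=\prod_{k=0}^{n-1}(1-aq^k)$. *)

theory Defs
  imports "HOL-Analysis.Analysis"
begin

text \<open>
  The \<open>q\<close>-shifted factorials \<open>(a;q)\<^sub>n\<close> and \<open>(a;q)\<^sub>\<infinity>\<close>.
  The infinite product is only meaningful for \<open>norm q < 1\<close>, where it converges for every \<open>a\<close>.
\<close>

definition qpoch :: "complex \<Rightarrow> complex \<Rightarrow> nat \<Rightarrow> complex" where
  "qpoch a q n = (\<Prod>k<n. 1 - a * q ^ k)"

definition qpoch_inf :: "complex \<Rightarrow> complex \<Rightarrow> complex" where
  "qpoch_inf a q = (\<Prod>k. 1 - a * q ^ k)"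

end

theory Submission
  imports Defs
begin

text \<open>
  Put \<open>T(d) = d(d-1)/2\<close>. With \<open>n = 2i\<close> or \<open>n = 2i+1\<close> and \<open>m = 0\<close> or \<open>m = 1\<close>, the
  exponents become \<open>T(n-j-m) + T(j+1)\<close> (up to the factor \<open>q\<^sup>-\<^sup>1\<close> in the third sum), so all four
  double sums are the even or odd part in \<open>n\<close> of
  \<open>\<Sum> q\<^bsup>T(n-j-m)+T(j+1)\<^esup> / ((q;q)\<^sub>n (q;q)\<^sub>j)\<close>. For fixed \<open>j\<close>, Euler's identity
  shows that the even and the odd part of the sum over \<open>n\<close> are both equal to
  \<open>(-q;q)\<^sub>\<infinity> (-q;q)\<^bsub>j+m\<^esub>\<close>. The remaining sum over \<open>j\<close> is Lebesgue's identity
  \<open>\<Sum> q\<^bsup>T(j+1)\<^esup> (-aq;q)\<^sub>j / (q;q)\<^sub>j = (-aq\<^sup>2;q\<^sup>2)\<^sub>\<infinity> (-q;q)\<^sub>\<infinity>\<close> with \<open>a = 1\<close> or \<open>a = q\<close>.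
  The identities of Euler and Lebesgue both follow by iterating a first-order functional equation.
\<close>

subsection \<open>Shifted factorials\<close>

lemma qpoch_0 [simp]: "qpoch a q 0 = 1"
  by (simp add: qpoch_def)

lemma qpoch_Suc: "qpoch a q (Suc n) = qpoch a q n * (1 - a * q ^ n)"
  by (simp add: qpoch_def)

lemma qpoch_Suc_shift: "qpoch a q (Suc n) = (1 - a) * qpoch (a * q) q n"
  unfolding qpoch_def by (subst prod.lessThan_Suc_shift) (simp add: mult.assoc)

lemma qpoch_LIMSEQ:
  assumes "norm q < 1"
  shows "qpoch a q \<longlonglongrightarrow> qpoch_inf a q"
proof -
  have "summable (\<lambda>k. norm (- a * q ^ k))"
    using assms by (simp add: norm_mult norm_power summable_mult summable_geometric)
  then have "convergent_prod (\<lambda>k. 1 - a * q ^ k)"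
    by (intro abs_convergent_prod_imp_convergent_prod summable_imp_abs_convergent_prod) simp
  then have "(\<lambda>n. \<Prod>k\<le>n. 1 - a * q ^ k) \<longlonglongrightarrow> qpoch_inf a q"
    unfolding qpoch_inf_def using convergent_prod_LIMSEQ by fastforce
  then have "(\<lambda>n. qpoch a q (Suc n)) \<longlonglongrightarrow> qpoch_inf a q"
    by (simp add: qpoch_def lessThan_Suc_atMost)
  then show ?thesis
    by (rule LIMSEQ_imp_Suc)
qed

lemma power_neq_one:
  fixes q :: complex
  assumes "norm q < 1"
  shows "q ^ Suc k \<noteq> 1"
proof
  assume "q ^ Suc k = 1"
  then have "norm q ^ Suc k = 1"
    by (metis norm_one norm_power)
  moreover have "norm q ^ Suc k < 1"
    using assms by (simp add: power_less_one_iff del: power_Suc)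
  ultimately show False by simp
qed

lemma qpoch_nonzero:
  assumes "norm q < 1"
  shows "qpoch q q n \<noteq> 0"
  using power_neq_one[OF assms] by (auto simp: qpoch_def)

lemma qpoch_inf_nonzero:
  assumes "norm q < 1"
  shows "qpoch_inf q q \<noteq> 0"
proof -
  have "summable (\<lambda>k. norm (- q * q ^ k))"
    using assms by (simp add: norm_mult norm_power summable_mult summable_geometric)
  then have "convergent_prod (\<lambda>k. 1 - q * q ^ k)"
    by (intro abs_convergent_prod_imp_convergent_prod summable_imp_abs_convergent_prod) simp
  moreover have "1 - q * q ^ k \<noteq> 0" for k
    using power_neq_one[OF assms, of k] by auto
  ultimately show ?thesis
    unfolding qpoch_inf_def using prodinf_nonzero by fastforce
qed

lemma qpoch_inf_shift:
  assumes "norm q < 1"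
  shows "qpoch_inf a q = (1 - a) * qpoch_inf (a * q) q"
proof -
  have "(\<lambda>n. qpoch a q (Suc n)) \<longlonglongrightarrow> (1 - a) * qpoch_inf (a * q) q"
    unfolding qpoch_Suc_shift by (intro tendsto_intros qpoch_LIMSEQ assms)
  moreover have "(\<lambda>n. qpoch a q (Suc n)) \<longlonglongrightarrow> qpoch_inf a q"
    by (intro LIMSEQ_Suc qpoch_LIMSEQ assms)
  ultimately show ?thesis
    using LIMSEQ_unique by blast
qed

text \<open>Each factor is at most \<open>exp (norm a * norm q ^ k)\<close> because
  \<open>1 + x \<le> exp x\<close>, and the exponents form a geometric series. The bound is uniform
  in \<open>n\<close> and depends on \<open>a\<close> only through its norm, which the limits in the
  parameter require.\<close>

lemma norm_qpoch_le:
  assumes "norm q < 1"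
  shows "norm (qpoch a q n) \<le> exp (norm a / (1 - norm q))"
proof -
  have "norm (qpoch a q n) \<le> (\<Prod>k<n. exp (norm a * norm q ^ k))"
    unfolding qpoch_def prod_norm [symmetric]
  proof (intro prod_mono conjI norm_ge_zero)
    fix k
    have "norm (1 - a * q ^ k) \<le> 1 + norm a * norm q ^ k"
      by (metis norm_triangle_ineq4 norm_one norm_mult norm_power)
    also have "\<dots> \<le> exp (norm a * norm q ^ k)"
      by (rule exp_ge_add_one_self)
    finally show "norm (1 - a * q ^ k) \<le> exp (norm a * norm q ^ k)" .
  qed
  also have "\<dots> = exp (norm a * (\<Sum>k<n. norm q ^ k))"
    by (simp add: exp_sum sum_distrib_left)
  also have "\<dots> \<le> exp (norm a * (1 / (1 - norm q)))"
  proof -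
    have "(\<Sum>k<n. norm q ^ k) \<le> (\<Sum>k. norm q ^ k)"
      using assms by (intro sum_le_suminf summable_geometric) auto
    also have "\<dots> = 1 / (1 - norm q)"
      using assms by (intro suminf_geometric) auto
    finally show ?thesis
      by (intro iffD2[OF exp_le_cancel_iff] mult_left_mono) auto
  qed
  finally show ?thesis by simp
qed

text \<open>The limit of \<open>qpoch q q n\<close> is nonzero, so the reciprocals converge and are
  therefore bounded.\<close>

lemma inverse_qpoch_bounded:
  assumes "norm q < 1"
  obtains K where "K > 0" "\<And>n. norm (1 / qpoch q q n) \<le> K"
proof -
  have "(\<lambda>n. 1 / qpoch q q n) \<longlonglongrightarrow> 1 / qpoch_inf q q"
    by (intro tendsto_intros qpoch_LIMSEQ qpoch_inf_nonzero assms)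
  then have "Bseq (\<lambda>n. 1 / qpoch q q n)"
    by (intro convergent_imp_Bseq convergentI)
  then show ?thesis
    using that unfolding Bseq_def by blast
qed

lemma qpoch_split: "qpoch a q (2 * n) = qpoch a (q ^ 2) n * qpoch (a * q) (q ^ 2) n"
  by (induction n) (simp_all add: qpoch_Suc power_mult [symmetric] algebra_simps)

lemma qpoch_minus: "qpoch a q n * qpoch (- a) q n = qpoch (a ^ 2) (q ^ 2) n"
  by (induction n) (simp_all add: qpoch_Suc power2_eq_square power_mult_distrib algebra_simps)

lemma qpoch_inf_split:
  assumes "norm q < 1"
  shows "qpoch_inf a q = qpoch_inf a (q ^ 2) * qpoch_inf (a * q) (q ^ 2)"
proof -
  have q2: "norm (q ^ 2) < 1"
    using assms by (simp add: norm_power power_less_one_iff)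
  have "(\<lambda>n. qpoch a q (2 * n)) \<longlonglongrightarrow> qpoch_inf a q"
    using qpoch_LIMSEQ[OF assms] by (rule LIMSEQ_subseq_LIMSEQ[unfolded o_def]) (simp add: strict_mono_def)
  moreover have "(\<lambda>n. qpoch a q (2 * n)) \<longlonglongrightarrow> qpoch_inf a (q ^ 2) * qpoch_inf (a * q) (q ^ 2)"
    unfolding qpoch_split by (intro tendsto_intros qpoch_LIMSEQ q2)
  ultimately show ?thesis
    using LIMSEQ_unique by blast
qed

text \<open>Euler's theorem on partitions into odd and into distinct parts. Difference of squares
  gives \<open>(q;q) (-q;q) = (q^2;q^2)\<close> for the infinite products, while separating even and
  odd powers gives \<open>(q;q) = (q;q^2) (q^2;q^2)\<close>; the nonzero factor \<open>(q;q)\<close>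
  cancels.\<close>

lemma qpoch_inf_euler_odd:
  assumes "norm q < 1"
  shows "qpoch_inf (- q) q * qpoch_inf q (q ^ 2) = 1"
proof -
  have q2: "norm (q ^ 2) < 1"
    using assms by (simp add: norm_power power_less_one_iff)
  have "(\<lambda>n. qpoch q q n * qpoch (- q) q n) \<longlonglongrightarrow> qpoch_inf q q * qpoch_inf (- q) q"
    by (intro tendsto_intros qpoch_LIMSEQ assms)
  then have "qpoch_inf q q * qpoch_inf (- q) q = qpoch_inf (q ^ 2) (q ^ 2)"
    unfolding qpoch_minus using qpoch_LIMSEQ[OF q2] LIMSEQ_unique by blast
  moreover have "qpoch_inf q q = qpoch_inf q (q ^ 2) * qpoch_inf (q ^ 2) (q ^ 2)"
    using qpoch_inf_split[OF assms, of q] by (simp add: power2_eq_square)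
  ultimately have "qpoch_inf q q * (qpoch_inf (- q) q * qpoch_inf q (q ^ 2)) = qpoch_inf q q"
    by (simp add: mult_ac)
  then show ?thesis
    using qpoch_inf_nonzero[OF assms] by simp
qed

text \<open>Common engine for the two classical identities: \<open>n\<close> applications of the
  equation leave \<open>f (z * p ^ n)\<close> times a finite shifted factorial, and then
  \<open>n\<close> tends to infinity. Euler's case has \<open>p = q\<close>, \<open>c = 1\<close>;
  Lebesgue's has \<open>p = c = q ^ 2\<close>.\<close>

lemma functional_equation_qpoch_inf:
  fixes f :: "complex \<Rightarrow> complex"
  assumes p: "norm p < 1"
    and step: "\<And>n. f (z * p ^ n) = (1 + z * c * p ^ n) * f (z * p ^ Suc n)"
    and lim: "(\<lambda>n. f (z * p ^ n)) \<longlonglongrightarrow> l"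
  shows "f z = qpoch_inf (- (z * c)) p * l"
proof -
  have "f z = qpoch (- (z * c)) p n * f (z * p ^ n)" for n
    by (induction n) (auto simp: qpoch_Suc step)
  moreover have "(\<lambda>n. qpoch (- (z * c)) p n * f (z * p ^ n)) \<longlonglongrightarrow> qpoch_inf (- (z * c)) p * l"
    by (intro tendsto_intros qpoch_LIMSEQ p lim)
  ultimately have "(\<lambda>n. f z) \<longlonglongrightarrow> qpoch_inf (- (z * c)) p * l"
    by simp
  then show ?thesis
    by (simp add: LIMSEQ_const_iff)
qed

subsection \<open>Triangular exponents\<close>

text \<open>The argument is an integer since \<open>n - j - m\<close> may be negative. The value is
  a natural number, as \<open>d * (d - 1)\<close> is even and nonnegative for every integer, so
  ordinary powers of \<open>q\<close> suffice, also at \<open>q = 0\<close>.\<close>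

definition tri :: "int \<Rightarrow> nat" where
  "tri d = nat (d * (d - 1) div 2)"

lemma tri_double: "2 * int (tri d) = d * (d - 1)"
proof -
  have "0 \<le> d * (d - 1)"
    by (cases "d \<ge> 1") (auto intro: mult_nonpos_nonpos)
  moreover have "even (d * (d - 1))"
    by simp
  ultimately show ?thesis
    by (auto simp: tri_def)
qed

lemma tri_eqI: "2 * int n = d * (d - 1) \<Longrightarrow> tri d = n"
  using tri_double[of d] by simp

lemma tri_0_1 [simp]: "tri 0 = 0" "tri 1 = 0"
  by (auto intro!: tri_eqI)

lemma tri_Suc: "tri (int (Suc n)) = tri (int n) + n"
  by (rule tri_eqI) (use tri_double[of "int n"] in \<open>simp add: algebra_simps\<close>)

lemma int_mult_pred_nonneg: "0 \<le> d * (d - 1)" for d :: int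
  using tri_double[of d] by (metis of_nat_0_le_iff zero_le_mult_iff zero_le_numeral)

text \<open>Equivalent to \<open>(d - 1) * (d - 2) \<ge> 0\<close>.\<close>

lemma tri_ge: "d - 1 \<le> int (tri d)"
  using tri_double[of d] int_mult_pred_nonneg[of "d - 1"] by (simp add: algebra_simps)

text \<open>Equivalent to \<open>(n - 1) * (n - 2) \<ge> 0\<close>. Slope 2 matters in the double
  sum: one \<open>j\<close> offsets the loss in \<open>tri (n - j - m)\<close>, the other provides
  decay in \<open>j\<close>.\<close>

lemma tri_Suc_ge: "2 * int n - 1 \<le> int (tri (int (Suc n)))"
  using tri_double[of "int (Suc n)"] int_mult_pred_nonneg[of "int n - 1"] by (simp add: algebra_simps)

section \<open>Geometric domination and limits under the sum\<close>

lemma norm_power_le_geometric: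
  fixes q :: complex
  assumes "norm q < 1"
  obtains R where "0 < R" "R < 1" "\<And>e n k. n \<le> e + k \<Longrightarrow> norm (q ^ e) \<le> R ^ n / R ^ k"
proof
  \<comment> \<open>The midpoint of \<open>norm q\<close> and 1 is positive even for
    \<open>q = 0\<close>, so division by \<open>R ^ k\<close> is legitimate.\<close>
  define R where "R = (1 + norm q) / 2"
  show R: "0 < R" "R < 1"
    using assms by (auto simp: R_def add_pos_nonneg)
  show "norm (q ^ e) \<le> R ^ n / R ^ k" if "n \<le> e + k" for e n k
  proof -
    have "norm (q ^ e) \<le> R ^ e"
      unfolding norm_power using assms by (intro power_mono) (auto simp: R_def)
    moreover have "R ^ e * R ^ k \<le> R ^ n"
      unfolding power_add [symmetric] using R that by (intro power_decreasing) auto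
    ultimately have "norm (q ^ e) * R ^ k \<le> R ^ n"
      using R by (meson less_imp_le mult_right_mono order_trans zero_le_power)
    then show ?thesis
      using R by (simp add: pos_le_divide_eq)
  qed
qed

lemma power_series_dominated:
  fixes c :: "nat \<Rightarrow> nat \<Rightarrow> complex"
  assumes q: "norm q < 1"
    and e: "\<And>n. n \<le> e n + k"
    and c: "\<And>n m. norm (c n m) \<le> C"
  obtains M where "summable M" "\<And>n m. norm (q ^ e n * c n m) \<le> M n"
proof -
  obtain R where R: "0 < R" "R < 1" "\<And>e n k. n \<le> e + k \<Longrightarrow> norm (q ^ e) \<le> R ^ n / R ^ k"
    using norm_power_le_geometric[OF q] by blast
  show ?thesis
  proof
    show "summable (\<lambda>n. R ^ n / R ^ k * C)"
      using R by (intro summable_mult2 summable_divide summable_geometric) auto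
    show "norm (q ^ e n * c n m) \<le> R ^ n / R ^ k * C" for n m
      unfolding norm_mult using R e c by (intro mult_mono) auto
  qed
qed

lemma summable_norm_power_mult:
  assumes "norm q < 1" "\<And>n. n \<le> e n + k" "\<And>n. norm (c n) \<le> C"
  shows "summable (\<lambda>n. norm (q ^ e n * c n :: complex))"
proof -
  obtain M where "summable M" "\<And>n m::nat. norm (q ^ e n * c n) \<le> M n"
    using power_series_dominated[of q e k "\<lambda>n m. c n"] assms by metis
  then show ?thesis
    using summable_comparison_test'[of M 0 "\<lambda>n. norm (q ^ e n * c n)"] by simp
qed

text \<open>Tannery's theorem, that is, dominated convergence for series: the geometric majorant
  does not depend on \<open>m\<close>.\<close>

lemma tendsto_suminf_power_mult:
  fixes c :: "nat \<Rightarrow> nat \<Rightarrow> complex"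
  assumes "norm q < 1" "\<And>n. n \<le> e n + k" "\<And>n m. norm (c n m) \<le> C"
    and lim: "\<And>n. c n \<longlonglongrightarrow> l n"
  shows "(\<lambda>m. \<Sum>n. q ^ e n * c n m) \<longlonglongrightarrow> (\<Sum>n. q ^ e n * l n)"
proof -
  obtain M where M: "summable M" "\<And>n m. norm (q ^ e n * c n m) \<le> M n"
    using power_series_dominated assms by metis
  have "(\<lambda>m. q ^ e n * c n m) \<longlonglongrightarrow> q ^ e n * l n" for n
    by (intro tendsto_intros lim)
  moreover have "\<forall>\<^sub>F (n, m) in sequentially \<times>\<^sub>F sequentially. norm (q ^ e n * c n m) \<le> M n"
    using M by (intro always_eventually) auto
  ultimately show ?thesis
    using M by (intro tannerys_theorem[where M = M, THEN conjunct2, THEN conjunct2]) auto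
qed

text \<open>A prepended zero term expresses the shift from \<open>n\<close> to \<open>n - 1\<close>,
  with value 0 at \<open>n = 0\<close>; it serves the telescoping and the parity recurrence.\<close>

lemma sums_case_nat:
  fixes f :: "nat \<Rightarrow> 'a::real_normed_vector"
  shows "f sums s \<Longrightarrow> case_nat 0 f sums s"
  using sums_Suc_iff[of "case_nat 0 f" s] by simp

subsection \<open>Euler's identity\<close>

lemma summable_euler:
  assumes q: "norm q < 1" and z: "norm z \<le> 1"
  shows "summable (\<lambda>n. q ^ tri (int n) * (z ^ n / qpoch q q n))"
proof -
  obtain K where K: "K > 0" "\<And>n. norm (1 / qpoch q q n) \<le> K"
    using inverse_qpoch_bounded[OF q] by blast
  have "norm (z ^ n / qpoch q q n) \<le> 1 * K" for n
    using K z mult_mono[of "norm (z ^ n)" 1 "norm (1 / qpoch q q n)" K]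
    by (simp add: norm_power norm_divide power_le_one)
  moreover have "n \<le> tri (int n) + 1" for n
    using tri_ge[of "int n"] by simp
  ultimately show ?thesis
    by (intro summable_norm_cancel[OF summable_norm_power_mult[OF q]])
qed

lemma euler_functional_equation:
  assumes q: "norm q < 1" and z: "norm z \<le> 1"
  defines "E \<equiv> \<lambda>z. \<Sum>n. q ^ tri (int n) * (z ^ n / qpoch q q n)"
  shows "E z = (1 + z) * E (z * q)"
proof -
  define t where "t z n = q ^ tri (int n) * (z ^ n / qpoch q q n)" for z n
  have zq: "norm (z * q) \<le> 1"
    using q z by (simp add: norm_mult mult_le_one)
  have sums: "t z sums E z" "t (z * q) sums E (z * q)"
    unfolding t_def E_def using summable_euler[OF q z] summable_euler[OF q zq] by (simp_all add: summable_sums)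
  \<comment> \<open>The difference carries the factor \<open>1 - q ^ n\<close>, which cancels the
    last factor of \<open>qpoch q q n\<close>. The leftover power \<open>q ^ (n - 1)\<close> from
    \<open>tri\<close> turns \<open>z ^ (n - 1)\<close> into
    \<open>(z * q) ^ (n - 1)\<close>.\<close>
  have "t z n - t (z * q) n = case_nat 0 (\<lambda>n. z * t (z * q) n) n" for n
  proof (cases n)
    case (Suc m)
    define w where "w = 1 - q * q ^ m"
    define c where "c = q ^ tri (int m) * (z * q) ^ m / qpoch q q m"
    have "w \<noteq> 0"
      using power_neq_one[OF q, of m] by (auto simp: w_def)
    have "t z n = z * c / w" "t (z * q) n = z * c * (1 - w) / w"
      unfolding Suc t_def tri_Suc qpoch_Suc c_def w_def
      by (simp_all add: power_add power_mult_distrib mult_ac)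
    then have "t z n - t (z * q) n = z * c * w / w"
      by (simp add: algebra_simps diff_divide_distrib)
    then show ?thesis
      using \<open>w \<noteq> 0\<close> by (simp add: Suc t_def c_def)
  qed (simp add: t_def)
  moreover have "case_nat 0 (\<lambda>n. z * t (z * q) n) sums (z * E (z * q))"
    by (intro sums_case_nat sums_mult sums)
  ultimately have "(\<lambda>n. t z n - t (z * q) n) sums (z * E (z * q))"
    by presburger
  moreover have "(\<lambda>n. t z n - t (z * q) n) sums (E z - E (z * q))"
    by (intro sums_diff sums)
  ultimately have "E z - E (z * q) = z * E (z * q)"
    using sums_unique2 by blast
  then show ?thesis
    by (simp add: algebra_simps)
qed

text \<open>Iterating the functional equation moves \<open>z\<close> to 0, where only the term
  \<open>n = 0\<close> survives. The boundary points \<open>z = 1\<close> and \<open>z = - 1\<close>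
  are included because the parity argument evaluates there.\<close>

lemma euler_sums:
  assumes q: "norm q < 1" and z: "norm z \<le> 1"
  shows "(\<lambda>n. q ^ tri (int n) * (z ^ n / qpoch q q n)) sums qpoch_inf (- z) q"
proof -
  define E where "E z = (\<Sum>n. q ^ tri (int n) * (z ^ n / qpoch q q n))" for z
  obtain K where K: "K > 0" "\<And>n. norm (1 / qpoch q q n) \<le> K"
    using inverse_qpoch_bounded[OF q] by blast
  have zq: "norm (z * q ^ n) \<le> 1" for n
    using q z by (simp add: norm_mult norm_power mult_le_one power_le_one)
  have "E z = qpoch_inf (- (z * 1)) q * 1"
  proof (rule functional_equation_qpoch_inf)
    show "E (z * q ^ n) = (1 + z * 1 * q ^ n) * E (z * q ^ Suc n)" for n
      using euler_functional_equation[OF q zq] by (simp add: E_def mult_ac)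
    have "(\<lambda>m. \<Sum>n. q ^ tri (int n) * ((z * q ^ m) ^ n / qpoch q q n))
      \<longlonglongrightarrow> (\<Sum>n. q ^ tri (int n) * (0 ^ n / qpoch q q n))"
    proof (rule tendsto_suminf_power_mult[OF q])
      show "n \<le> tri (int n) + 1" for n
        using tri_ge[of "int n"] by simp
      show "norm ((z * q ^ m) ^ n / qpoch q q n) \<le> 1 * K" for n m
        using K zq mult_mono[of "norm ((z * q ^ m) ^ n)" 1 "norm (1 / qpoch q q n)" K]
        by (simp add: norm_power[of "z * q ^ m"] norm_divide power_le_one)
      have "(\<lambda>m. q ^ m) \<longlonglongrightarrow> 0"
        using q by (rule LIMSEQ_power_zero)
      then have "(\<lambda>m. z * q ^ m) \<longlonglongrightarrow> 0"
        using tendsto_mult_right_zero by blast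
      then show "(\<lambda>m. (z * q ^ m) ^ n / qpoch q q n) \<longlonglongrightarrow> 0 ^ n / qpoch q q n" for n
        by (intro tendsto_intros qpoch_nonzero q)
    qed
    moreover have "(\<Sum>n. q ^ tri (int n) * (0 ^ n / qpoch q q n)) = 1"
      by (subst suminf_finite[of "{0}"]) auto
    ultimately show "(\<lambda>n. E (z * q ^ n)) \<longlonglongrightarrow> 1"
      by (simp add: E_def)
  qed (fact q)
  then show ?thesis
    using summable_sums[OF summable_euler[OF q z]] by (simp add: E_def)
qed

subsection \<open>Lebesgue's identity\<close>

text \<open>Uniformity over the disc of radius \<open>B\<close> is what allows \<open>b\<close> to
  vary when the limit is taken under the sum.\<close>

lemma lebesgue_coeff_bounded:
  assumes q: "norm q < 1"
  obtains C where "\<And>(b::complex) j. norm b \<le> B \<Longrightarrow> norm (qpoch b q j / qpoch q q j) \<le> C"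
proof -
  obtain K where K: "K > 0" "\<And>n. norm (1 / qpoch q q n) \<le> K"
    using inverse_qpoch_bounded[OF q] by blast
  show ?thesis
  proof
    fix b :: complex and j assume b: "norm b \<le> B"
    have "norm (qpoch b q j) \<le> exp (norm b / (1 - norm q))"
      using norm_qpoch_le[OF q] .
    also have "\<dots> \<le> exp (B / (1 - norm q))"
      using b q by (simp add: divide_right_mono)
    finally show "norm (qpoch b q j / qpoch q q j) \<le> exp (B / (1 - norm q)) * K"
      using K(2)[of j] K(1)
        mult_mono[of "norm (qpoch b q j)" "exp (B / (1 - norm q))" "norm (1 / qpoch q q j)" K]
      by (simp add: norm_divide)
  qed
qed

lemma summable_norm_lebesgue:
  assumes q: "norm q < 1" and e: "\<And>j. j \<le> e j + k"
  shows "summable (\<lambda>j. norm (q ^ e j * (qpoch b q j / qpoch q q j)))"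
proof -
  obtain C where "\<And>b' j. norm b' \<le> norm b \<Longrightarrow> norm (qpoch b' q j / qpoch q q j) \<le> C"
    using lebesgue_coeff_bounded[OF q, of "norm b"] by blast
  then show ?thesis
    using e by (intro summable_norm_power_mult[OF q]) auto
qed

lemma le_tri_Suc: "j \<le> tri (int (Suc j)) + 1"
  using tri_Suc_ge[of j] by simp

text \<open>The difference of the two sides telescopes; the sequence \<open>V\<close> below was found
  with the Wilf-Zeilberger ansatz.\<close>

lemma lebesgue_functional_equation:
  assumes q: "norm q < 1"
  defines "L \<equiv> \<lambda>a. \<Sum>j. q ^ tri (int (Suc j)) * (qpoch (- (a * q)) q j / qpoch q q j)"
  shows "L a = (1 + a * q ^ 2) * L (a * q ^ 2)"
proof -
  define t where "t a j = q ^ tri (int (Suc j)) * (qpoch (- (a * q)) q j / qpoch q q j)" for a j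
  define V where "V j = - (a * q) * (q ^ tri (int (Suc (Suc j))) * (qpoch (- (a * q ^ 2)) q j / qpoch q q j))" for j
  have sums: "t a sums L a" for a
    unfolding t_def L_def
    by (intro summable_sums summable_norm_cancel[OF summable_norm_lebesgue[OF q le_tri_Suc]])
  have "j \<le> tri (int (Suc (Suc j))) + 1" for j
    using le_tri_Suc[of "Suc j"] by simp
  then have V: "V sums suminf V"
    unfolding V_def
    by (intro summable_sums summable_mult summable_norm_cancel[OF summable_norm_lebesgue[OF q]])
  have diff: "t a j - (1 + a * q ^ 2) * t (a * q ^ 2) j = V j - case_nat 0 V j" for j
  proof (cases j)
    case 0
    have "tri (int (Suc (Suc 0))) = 1"
      by (simp add: tri_Suc del: of_nat_Suc)
    then show ?thesis
      by (simp add: 0 t_def V_def algebra_simps power2_eq_square)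
  next
    case (Suc i)
    define P where "P = qpoch (- (a * q ^ 2)) q i"
    define D where "D = qpoch q q i"
    define T where "T = q ^ tri (int (Suc (Suc i)))"
    define x where "x = q ^ Suc i"
    have x: "1 - x \<noteq> 0" and D: "D \<noteq> 0"
      using power_neq_one[OF q, of i] qpoch_nonzero[OF q] by (auto simp: x_def D_def)
    have D': "qpoch q q (Suc i) = D * (1 - x)"
      by (simp add: qpoch_Suc D_def x_def)
    have "qpoch (- (a * q)) q (Suc i) = (1 + a * q) * P"
      by (simp add: qpoch_Suc_shift P_def power2_eq_square mult_ac)
    then have t1: "t a j = T * ((1 + a * q) * P / (D * (1 - x)))"
      by (simp add: t_def Suc D' T_def del: of_nat_Suc)
    \<comment> \<open>The prefactor is the missing first factor, so this term too becomes a multiple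
      of \<open>P\<close>.\<close>
    have "(1 + a * q ^ 2) * qpoch (- (a * q ^ 2 * q)) q (Suc i) = qpoch (- (a * q ^ 2)) q (Suc (Suc i))"
      by (subst (2) qpoch_Suc_shift) (simp add: mult_ac)
    also have "\<dots> = P * (1 + a * q * x) * (1 + a * q ^ 2 * x)"
      by (simp add: qpoch_Suc P_def x_def power2_eq_square mult_ac)
    finally have t2: "(1 + a * q ^ 2) * t (a * q ^ 2) j = T * (P * (1 + a * q * x) * (1 + a * q ^ 2 * x) / (D * (1 - x)))"
      by (simp add: t_def Suc D' T_def mult_ac del: of_nat_Suc)
    have "q ^ tri (int (Suc (Suc (Suc i)))) = T * (x * q)"
      by (subst tri_Suc) (simp add: power_add T_def x_def mult_ac del: of_nat_Suc)
    moreover have "qpoch (- (a * q ^ 2)) q (Suc i) = P * (1 + a * q * x)"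
      by (simp add: qpoch_Suc P_def x_def power2_eq_square mult_ac)
    ultimately have V1: "V j = - (a * q) * (T * (x * q) * (P * (1 + a * q * x) / (D * (1 - x))))"
      by (simp add: V_def Suc D' del: of_nat_Suc)
    have V2: "case_nat 0 V j = - (a * q) * (T * (P * (1 - x) / (D * (1 - x))))"
      using x by (simp add: V_def Suc P_def D_def T_def del: of_nat_Suc)
    have "t a j - (1 + a * q ^ 2) * t (a * q ^ 2) j =
      T * P / (D * (1 - x)) * ((1 + a * q) - (1 + a * q * x) * (1 + a * q ^ 2 * x))"
      unfolding t1 t2 by (simp add: algebra_simps diff_divide_distrib add_divide_distrib)
    \<comment> \<open>With the common factor \<open>T * P / (D * (1 - x))\<close> removed, the
      telescoping claim is this polynomial identity in \<open>a\<close>, \<open>q\<close> and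
      \<open>x\<close>.\<close>
    also have "(1 + a * q) - (1 + a * q * x) * (1 + a * q ^ 2 * x) =
      - (a * q) * (x * q * (1 + a * q * x) - (1 - x))"
      by algebra
    also have "T * P / (D * (1 - x)) * \<dots> = V j - case_nat 0 V j"
      unfolding V1 V2 by (simp add: algebra_simps diff_divide_distrib add_divide_distrib)
    finally show ?thesis .
  qed
  \<comment> \<open>\<open>V\<close> and its shift have the same sum, so the two sides of the
    functional equation differ by 0.\<close>
  have "(\<lambda>j. V j - case_nat 0 V j) sums (suminf V - suminf V)"
    by (intro sums_diff sums_case_nat V)
  moreover have "(\<lambda>j. V j - case_nat 0 V j) sums (L a - (1 + a * q ^ 2) * L (a * q ^ 2))"
    unfolding diff [symmetric] by (intro sums_diff sums_mult sums)
  ultimately show ?thesis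
    using sums_unique2 by fastforce
qed

lemma lebesgue_sums:
  assumes q: "norm q < 1"
  shows "(\<lambda>j. q ^ tri (int (Suc j)) * (qpoch (- (a * q)) q j / qpoch q q j))
    sums (qpoch_inf (- (a * q ^ 2)) (q ^ 2) * qpoch_inf (- q) q)"
proof -
  define L where "L a = (\<Sum>j. q ^ tri (int (Suc j)) * (qpoch (- (a * q)) q j / qpoch q q j))" for a
  have q2: "norm (q ^ 2) < 1"
    using q by (simp add: norm_power power_less_one_iff)
  have "L a = qpoch_inf (- (a * q ^ 2)) (q ^ 2) * qpoch_inf (- q) q"
  proof (rule functional_equation_qpoch_inf[OF q2])
    show "L (a * (q ^ 2) ^ n) = (1 + a * q ^ 2 * (q ^ 2) ^ n) * L (a * (q ^ 2) ^ Suc n)" for n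
      using lebesgue_functional_equation[OF q, of "a * (q ^ 2) ^ n"] by (simp add: L_def mult_ac)
    obtain C where C: "\<And>b j. norm b \<le> norm a \<Longrightarrow> norm (qpoch b q j / qpoch q q j) \<le> C"
      using lebesgue_coeff_bounded[OF q, of "norm a"] by blast
    have "(\<lambda>m. \<Sum>j. q ^ tri (int (Suc j)) * (qpoch (- (a * (q ^ 2) ^ m * q)) q j / qpoch q q j))
      \<longlonglongrightarrow> (\<Sum>j. q ^ tri (int (Suc j)) * (1 / qpoch q q j))"
    proof (rule tendsto_suminf_power_mult[OF q le_tri_Suc])
      show "norm (qpoch (- (a * (q ^ 2) ^ m * q)) q j / qpoch q q j) \<le> C" for m j
      proof (rule C)
        have "norm ((q ^ 2) ^ m * q) \<le> 1"
          unfolding norm_mult norm_power using q by (intro mult_le_one power_le_one) auto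
        then show "norm (- (a * (q ^ 2) ^ m * q)) \<le> norm a"
          using mult_left_le[of "norm ((q ^ 2) ^ m * q)" "norm a"] by (simp add: norm_mult mult_ac)
      qed
      have "(\<lambda>m. (q ^ 2) ^ m) \<longlonglongrightarrow> 0"
        using q2 by (rule LIMSEQ_power_zero)
      then have "(\<lambda>m. (- (a * q)) * (q ^ 2) ^ m) \<longlonglongrightarrow> 0"
        by (rule tendsto_mult_right_zero)
      then have "(\<lambda>m. - (a * (q ^ 2) ^ m * q)) \<longlonglongrightarrow> 0"
        by (simp add: mult_ac)
      then have "(\<lambda>m. qpoch (- (a * (q ^ 2) ^ m * q)) q j) \<longlonglongrightarrow> (\<Prod>k<j. 1 - 0 * q ^ k)" for j
        unfolding qpoch_def by (intro tendsto_intros)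
      then show "(\<lambda>m. qpoch (- (a * (q ^ 2) ^ m * q)) q j / qpoch q q j) \<longlonglongrightarrow> 1 / qpoch q q j" for j
        by (intro tendsto_intros qpoch_nonzero q) simp
    qed
    \<comment> \<open>Since \<open>tri (j + 1) = tri j + j\<close>, the limiting series is Euler's
      at \<open>z = q\<close>.\<close>
    moreover have "(\<Sum>j. q ^ tri (int (Suc j)) * (1 / qpoch q q j)) = qpoch_inf (- q) q"
      using sums_unique[OF euler_sums[OF q, of q]] q
      by (simp add: tri_Suc power_add del: of_nat_Suc)
    ultimately show "(\<lambda>n. L (a * (q ^ 2) ^ n)) \<longlonglongrightarrow> qpoch_inf (- q) q"
      by (simp add: L_def del: of_nat_Suc)
  qed
  moreover have "summable (\<lambda>j. q ^ tri (int (Suc j)) * (qpoch (- (a * q)) q j / qpoch q q j))"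
    by (intro summable_norm_cancel[OF summable_norm_lebesgue[OF q le_tri_Suc]])
  ultimately show ?thesis
    using summable_sums by (simp add: L_def del: of_nat_Suc) fastforce
qed

subsection \<open>The double sums\<close>

text \<open>Write the numerator with \<open>1 = q ^ Suc n + (1 - q ^ Suc n)\<close>. The second part
  cancels a factor of the denominator; the first is rewritten by
  \<open>tri (d + 1) - tri d = d\<close> with \<open>d = n - N\<close>. One of the two resulting
  terms has \<open>n\<close> lowered by one, which exchanges the parities.\<close>

lemma tri_shift_recurrence:
  assumes q: "norm q < 1"
  defines "g \<equiv> \<lambda>N n. q ^ tri (int n - int N) / qpoch q q n"
  shows "g (Suc N) 0 = q ^ Suc N * g N 0"
    and "g (Suc N) (Suc n) = q ^ Suc N * g N (Suc n) + g N n"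
proof -
  have "tri (- int (Suc N)) = Suc N + tri (- int N)"
    by (rule tri_eqI) (use tri_double[of "- int N"] in \<open>simp add: algebra_simps\<close>)
  then show "g (Suc N) 0 = q ^ Suc N * g N 0"
    by (simp add: g_def power_add)
next
  define d where "d = int n - int N"
  have "int (tri d + Suc n) = int (Suc N + tri (d + 1))"
    using tri_double[of d] tri_double[of "d + 1"] by (simp add: d_def algebra_simps)
  then have "tri d + Suc n = Suc N + tri (d + 1)"
    by linarith
  then have e: "q ^ tri d * q ^ Suc n = q ^ Suc N * q ^ tri (d + 1)"
    by (metis power_add)
  define D where "D = qpoch q q n"
  define w where "w = 1 - q ^ Suc n"
  have nz: "w \<noteq> 0" "D \<noteq> 0"
    using power_neq_one[OF q, of n] qpoch_nonzero[OF q] by (auto simp: w_def D_def)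
  have D': "qpoch q q (Suc n) = D * w"
    by (simp add: qpoch_Suc D_def w_def)
  have "q ^ tri d = q ^ Suc N * q ^ tri (d + 1) + q ^ tri d * w"
    unfolding e [symmetric] w_def by (simp add: algebra_simps)
  then have "q ^ tri d / (D * w) = q ^ Suc N * (q ^ tri (d + 1) / (D * w)) + q ^ tri d / D"
    using nz by (metis add_divide_distrib nonzero_mult_divide_mult_cancel_right times_divide_eq_right)
  moreover have "int (Suc n) - int (Suc N) = d" "int (Suc n) - int N = d + 1"
    by (simp_all add: d_def)
  ultimately show "g (Suc N) (Suc n) = q ^ Suc N * g N (Suc n) + g N n"
    by (simp only: g_def D' D_def [symmetric] d_def [symmetric])
qed

text \<open>Even and odd terms contribute equally since the alternating sum is
  \<open>(1;q)\<^sub>\<infinity> = 0\<close> for \<open>N = 0\<close>, and the recurrence preserves this.\<close>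

lemma parity_sums:
  assumes q: "norm q < 1"
  defines "g \<equiv> \<lambda>N n. q ^ tri (int n - int N) / qpoch q q n"
  shows "(\<lambda>i. g N (2 * i)) sums (qpoch_inf (- q) q * qpoch (- q) q N)"
    and "(\<lambda>i. g N (Suc (2 * i))) sums (qpoch_inf (- q) q * qpoch (- q) q N)"
proof (induction N)
  case 0
  \<comment> \<open>Euler at \<open>z = 1\<close> gives the full sum and at \<open>z = - 1\<close>
    the alternating sum; their half-sum and half-difference isolate the even and the odd
    terms.\<close>
  have "qpoch_inf (- 1) q = 2 * qpoch_inf (- q) q" "qpoch_inf 1 q = 0"
    using qpoch_inf_shift[OF q, of "- 1"] qpoch_inf_shift[OF q, of 1] by simp_all
  with euler_sums[OF q, of 1] euler_sums[OF q, of "- 1"]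
  have *: "(\<lambda>n. g 0 n) sums (2 * qpoch_inf (- q) q)" "(\<lambda>n. (- 1) ^ n * g 0 n) sums 0"
    by (simp_all add: g_def mult_ac)
  have "(\<lambda>n. (g 0 n + (- 1) ^ n * g 0 n) / 2) sums ((2 * qpoch_inf (- q) q + 0) / 2)"
    by (intro sums_divide sums_add *)
  moreover have "strict_mono (\<lambda>i::nat. 2 * i)" and "\<And>n. n \<notin> range (\<lambda>i. 2 * i) \<Longrightarrow> odd (n::nat)"
    by (auto simp: strict_mono_def elim: evenE)
  ultimately have "(\<lambda>i. (g 0 (2 * i) + (- 1) ^ (2 * i) * g 0 (2 * i)) / 2) sums ((2 * qpoch_inf (- q) q + 0) / 2)"
    by (subst sums_mono_reindex[of "\<lambda>i. 2 * i"]) auto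
  then show "(\<lambda>i. g 0 (2 * i)) sums (qpoch_inf (- q) q * qpoch (- q) q 0)"
    by simp
  have "(\<lambda>n. (g 0 n - (- 1) ^ n * g 0 n) / 2) sums ((2 * qpoch_inf (- q) q - 0) / 2)"
    by (intro sums_divide sums_diff *)
  moreover have "strict_mono (\<lambda>i::nat. Suc (2 * i))"
    by (simp add: strict_mono_def)
  moreover have "even n" if "n \<notin> range (\<lambda>i. Suc (2 * i))" for n
  proof (rule ccontr)
    assume "odd n"
    then obtain k where "n = Suc (2 * k)"
      by (metis Suc_eq_plus1 oddE)
    then show False
      using that by blast
  qed
  ultimately have "(\<lambda>i. (g 0 (Suc (2 * i)) - (- 1) ^ Suc (2 * i) * g 0 (Suc (2 * i))) / 2) sums
      ((2 * qpoch_inf (- q) q - 0) / 2)"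
    by (subst sums_mono_reindex[of "\<lambda>i. Suc (2 * i)"]) auto
  then show "(\<lambda>i. g 0 (Suc (2 * i))) sums (qpoch_inf (- q) q * qpoch (- q) q 0)"
    by simp
next
  case (Suc N)
  define S where "S = qpoch_inf (- q) q * qpoch (- q) q N"
  \<comment> \<open>By induction both parities sum to \<open>S\<close>, so it is harmless that the
    recurrence mixes them: either way the new sum is \<open>(1 + q ^ Suc N) * S\<close>.\<close>
  have S: "qpoch_inf (- q) q * qpoch (- q) q (Suc N) = q ^ Suc N * S + S"
    by (simp add: S_def qpoch_Suc algebra_simps)
  have rec: "g (Suc N) 0 = q ^ Suc N * g N 0" "g (Suc N) (Suc n) = q ^ Suc N * g N (Suc n) + g N n" for n
    unfolding g_def by (rule tri_shift_recurrence[OF q])+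
  have "g (Suc N) (2 * i) = q ^ Suc N * g N (2 * i) + case_nat 0 (\<lambda>i. g N (Suc (2 * i))) i" for i
  proof (cases i)
    case 0
    show ?thesis
      using rec(1) by (simp only: 0 mult_0_right nat.case add_0_right)
  next
    case (Suc k)
    have "2 * Suc k = Suc (Suc (2 * k))"
      by simp
    then show ?thesis
      using rec(2)[of "Suc (2 * k)"] by (simp only: Suc nat.case)
  qed
  moreover have "(\<lambda>i. q ^ Suc N * g N (2 * i) + case_nat 0 (\<lambda>i. g N (Suc (2 * i))) i) sums (q ^ Suc N * S + S)"
    using Suc unfolding S_def by (rule sums_add[OF sums_mult sums_case_nat])
  ultimately show "(\<lambda>i. g (Suc N) (2 * i)) sums (qpoch_inf (- q) q * qpoch (- q) q (Suc N))"
    unfolding S by presburger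
  show "(\<lambda>i. g (Suc N) (Suc (2 * i))) sums (qpoch_inf (- q) q * qpoch (- q) q (Suc N))"
    unfolding S rec(2) using Suc(2,1) unfolding S_def by (rule sums_add[OF sums_mult])
qed

text \<open>The linear bounds on \<open>tri\<close> make the exponent at least
  \<open>i + j - (m + 2)\<close>, so a product of two geometric series dominates.\<close>

lemma double_term_summable:
  assumes q: "norm q < 1" and n: "\<And>i. i \<le> n i"
  shows "(\<lambda>(j, i). q ^ (tri (int (n i) - int (j + m)) + tri (int (Suc j)))
    / (qpoch q q (n i) * qpoch q q j)) summable_on UNIV"
proof -
  obtain K where K: "K > 0" "\<And>n. norm (1 / qpoch q q n) \<le> K"
    using inverse_qpoch_bounded[OF q] by blast
  obtain R where R: "0 < R" "R < 1" "\<And>e n k. n \<le> e + k \<Longrightarrow> norm (q ^ e) \<le> R ^ n / R ^ k"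
    using norm_power_le_geometric[OF q] by blast
  have geo: "((\<lambda>i. R ^ i) has_sum (1 / (1 - R))) UNIV"
    using R by (intro norm_summable_imp_has_sum geometric_sums) (auto simp: summable_geometric)
  have "(\<lambda>(j, i). R ^ j * R ^ i) summable_on (SIGMA j:UNIV. UNIV)"
  proof (rule summable_on_SigmaI)
    show "((\<lambda>i. case (j, i) of (j, i) \<Rightarrow> R ^ j * R ^ i) has_sum (R ^ j * (1 / (1 - R)))) UNIV" for j
      using geo by (simp only: prod.case) (rule has_sum_cmult_right)
    show "(\<lambda>j. R ^ j * (1 / (1 - R))) summable_on UNIV"
      using geo by (intro summable_on_cmult_left has_sum_imp_summable)
  qed (use R in auto)
  then have "(\<lambda>p. (case p of (j, i) \<Rightarrow> R ^ j * R ^ i) * (K * K / R ^ (m + 2))) summable_on UNIV"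
    by (intro summable_on_cmult_left) simp
  then show ?thesis
  proof (rule abs_summable_summable[OF Infinite_Sum.abs_summable_on_comparison_test'], clarify)
    fix j i
    define e where "e = tri (int (n i) - int (j + m)) + tri (int (Suc j))"
    have "int (j + i) \<le> int (e + (m + 2))"
      using tri_ge[of "int (n i) - int (j + m)"] tri_Suc_ge[of j] n[of i]
      by (simp add: e_def del: of_nat_Suc)
    then have "norm (q ^ e) \<le> R ^ (j + i) / R ^ (m + 2)"
      by (intro R) linarith
    moreover have "norm (1 / qpoch q q (n i)) * norm (1 / qpoch q q j) \<le> K * K"
      using K by (intro mult_mono) auto
    ultimately have "norm (q ^ e) * (norm (1 / qpoch q q (n i)) * norm (1 / qpoch q q j))
      \<le> R ^ (j + i) / R ^ (m + 2) * (K * K)"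
      by (rule mult_mono) (use R(1) in simp_all)
    then show "norm (q ^ e / (qpoch q q (n i) * qpoch q q j)) \<le> R ^ j * R ^ i * (K * K / R ^ (m + 2))"
      by (simp add: norm_divide norm_mult power_add mult_ac)
  qed
qed

text \<open>Fubini: absolute convergence permits summing over \<open>i\<close> first. Pairs are kept
  as \<open>(j, i)\<close> so that the inner index is \<open>i\<close>, and are swapped at the
  end.\<close>

lemma double_has_sum:
  assumes q: "norm q < 1" and n: "\<And>i. i \<le> n i"
    and inner: "\<And>N. (\<lambda>i. q ^ tri (int (n i) - int N) / qpoch q q (n i)) sums
      (qpoch_inf (- q) q * qpoch (- q) q N)"
    and outer: "(\<lambda>j. q ^ tri (int (Suc j)) * (qpoch (- q) q (j + m) / qpoch q q j)) sums s"
    and outer_summable: "summable (\<lambda>j. norm (q ^ tri (int (Suc j)) * (qpoch (- q) q (j + m) / qpoch q q j)))"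
  shows "((\<lambda>(i, j). q ^ (tri (int (n i) - int (j + m)) + tri (int (Suc j)))
    / (qpoch q q (n i) * qpoch q q j)) has_sum (qpoch_inf (- q) q * s)) UNIV"
proof -
  define F where "F = (\<lambda>(j, i). q ^ (tri (int (n i) - int (j + m)) + tri (int (Suc j)))
    / (qpoch q q (n i) * qpoch q q j))"
  have F: "F summable_on UNIV"
    unfolding F_def using double_term_summable[OF q n] .
  have "(F has_sum (qpoch_inf (- q) q * s)) (SIGMA j:UNIV. UNIV)"
  proof (rule has_sum_SigmaI)
    show "F summable_on (SIGMA j:UNIV. UNIV)"
      using F by simp
    show "((\<lambda>j. qpoch_inf (- q) q * (q ^ tri (int (Suc j)) * (qpoch (- q) q (j + m) / qpoch q q j)))
      has_sum (qpoch_inf (- q) q * s)) UNIV"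
      by (intro has_sum_cmult_right norm_summable_imp_has_sum outer outer_summable)
    fix j
    have "(\<lambda>i. F (j, i)) summable_on UNIV"
      using F by (intro summable_on_SigmaD1[of "\<lambda>j i. F (j, i)" UNIV "\<lambda>_. UNIV"]) auto
    moreover have "(\<lambda>i. F (j, i)) sums
      (q ^ tri (int (Suc j)) / qpoch q q j * (qpoch_inf (- q) q * qpoch (- q) q (j + m)))"
      using sums_mult[OF inner[of "j + m"], of "q ^ tri (int (Suc j)) / qpoch q q j"]
      by (simp add: F_def power_add mult_ac del: of_nat_Suc)
    \<comment> \<open>Unconditional summability and the ordered sum together fix the value, by
      uniqueness.\<close>
    ultimately have "((\<lambda>i. F (j, i)) has_sum
      (q ^ tri (int (Suc j)) / qpoch q q j * (qpoch_inf (- q) q * qpoch (- q) q (j + m)))) UNIV"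
      using has_sum_imp_sums sums_unique2 has_sum_infsum by metis
    then show "((\<lambda>i. F (j, i)) has_sum
      (qpoch_inf (- q) q * (q ^ tri (int (Suc j)) * (qpoch (- q) q (j + m) / qpoch q q j)))) UNIV"
      by (simp add: mult_ac del: of_nat_Suc)
  qed
  then have "(F has_sum (qpoch_inf (- q) q * s)) (UNIV \<times> UNIV)"
    by simp
  then show ?thesis
    by (subst (asm) has_sum_swap) (simp add: F_def case_prod_unfold)
qed

section \<open>Product evaluations for \<open>m = 0\<close> and \<open>m = 1\<close>\<close>

lemma double_has_sum_0:
  assumes q: "norm q < 1"
    and n: "n = (\<lambda>i. 2 * i) \<or> n = (\<lambda>i. 2 * i + 1)"
  shows "((\<lambda>(i, j). q ^ (tri (int (n i) - int j) + tri (int (Suc j)))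
    / (qpoch q q (n i) * qpoch q q j)) has_sum
    (1 / (qpoch_inf q (q ^ 2) ^ 2 * qpoch_inf (q ^ 2) (q ^ 4)))) UNIV"
proof -
  have q2: "norm (q ^ 2) < 1"
    using q by (simp add: norm_power power_less_one_iff)
  \<comment> \<open>Euler's theorem for \<open>q\<close> and for \<open>q ^ 2\<close> converts the
    product \<open>(-q;q)^2 (-q^2;q^2)\<close> delivered by Lebesgue's identity at
    \<open>a = 1\<close>.\<close>
  have X: "qpoch_inf (- q) q = 1 / qpoch_inf q (q ^ 2)"
    using qpoch_inf_euler_odd[OF q] by (metis mult_zero_right nonzero_eq_divide_eq zero_neq_one)
  have Y: "qpoch_inf (- (q ^ 2)) (q ^ 2) = 1 / qpoch_inf (q ^ 2) (q ^ 4)"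
    using qpoch_inf_euler_odd[OF q2]
    by (simp add: power_mult [symmetric]) (metis mult_zero_right nonzero_eq_divide_eq zero_neq_one)
  have "((\<lambda>(i, j). q ^ (tri (int (n i) - int (j + 0)) + tri (int (Suc j)))
    / (qpoch q q (n i) * qpoch q q j)) has_sum
    (qpoch_inf (- q) q * (qpoch_inf (- (q ^ 2)) (q ^ 2) * qpoch_inf (- q) q))) UNIV"
  proof (rule double_has_sum[OF q])
    show "(\<lambda>i. q ^ tri (int (n i) - int N) / qpoch q q (n i)) sums
      (qpoch_inf (- q) q * qpoch (- q) q N)" for N
      using n parity_sums[OF q, of N] by auto
    show "(\<lambda>j. q ^ tri (int (Suc j)) * (qpoch (- q) q (j + 0) / qpoch q q j)) sums
      (qpoch_inf (- (q ^ 2)) (q ^ 2) * qpoch_inf (- q) q)"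
      using lebesgue_sums[OF q, of 1] by simp
    show "summable (\<lambda>j. norm (q ^ tri (int (Suc j)) * (qpoch (- q) q (j + 0) / qpoch q q j)))"
      using summable_norm_lebesgue[OF q le_tri_Suc, of "- q"] by simp
  qed (use n in auto)
  then show ?thesis
    unfolding X Y by (simp add: power2_eq_square mult_ac)
qed

text \<open>Lebesgue's identity is used at \<open>a = q\<close>, multiplied by \<open>1 + q\<close>:
  this completes both \<open>(-q;q)\<close> at index \<open>j + 1\<close> and the product
  \<open>(-q;q^2)\<close>, which equals \<open>(-q;q) (q^2;q^4)\<close>.\<close>

lemma double_has_sum_1:
  assumes q: "norm q < 1"
    and n: "n = (\<lambda>i. 2 * i) \<or> n = (\<lambda>i. 2 * i + 1)"
  shows "((\<lambda>(i, j). q ^ (tri (int (n i) - int (Suc j)) + tri (int (Suc j)))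
    / (qpoch q q (n i) * qpoch q q j)) has_sum
    (qpoch_inf (q ^ 2) (q ^ 4) / qpoch_inf q (q ^ 2) ^ 3)) UNIV"
proof -
  have q2: "norm (q ^ 2) < 1"
    using q by (simp add: norm_power power_less_one_iff)
  have X: "qpoch_inf (- q) q = 1 / qpoch_inf q (q ^ 2)"
    using qpoch_inf_euler_odd[OF q] by (metis mult_zero_right nonzero_eq_divide_eq zero_neq_one)
  have "qpoch_inf (- (q ^ 2)) (q ^ 2) * qpoch_inf (q ^ 2) (q ^ 4) = 1"
    using qpoch_inf_euler_odd[OF q2] by (simp add: power_mult [symmetric])
  moreover have "qpoch_inf (- q) q = qpoch_inf (- q) (q ^ 2) * qpoch_inf (- (q ^ 2)) (q ^ 2)"
    using qpoch_inf_split[OF q, of "- q"] by (simp add: power2_eq_square)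
  ultimately have Z: "qpoch_inf (- q) (q ^ 2) = qpoch_inf (- q) q * qpoch_inf (q ^ 2) (q ^ 4)"
    by (simp add: mult.assoc)
  have coeff: "qpoch (- q) q (Suc j) = (1 + q) * qpoch (- (q * q)) q j" for j
    by (simp add: qpoch_Suc_shift)
  have "((\<lambda>(i, j). q ^ (tri (int (n i) - int (j + 1)) + tri (int (Suc j)))
    / (qpoch q q (n i) * qpoch q q j)) has_sum
    (qpoch_inf (- q) q * (qpoch_inf (- q) (q ^ 2) * qpoch_inf (- q) q))) UNIV"
  proof (rule double_has_sum[OF q])
    show "(\<lambda>i. q ^ tri (int (n i) - int N) / qpoch q q (n i)) sums
      (qpoch_inf (- q) q * qpoch (- q) q N)" for N
      using n parity_sums[OF q, of N] by auto
    show "(\<lambda>j. q ^ tri (int (Suc j)) * (qpoch (- q) q (j + 1) / qpoch q q j)) sums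
      (qpoch_inf (- q) (q ^ 2) * qpoch_inf (- q) q)"
      using sums_mult[OF lebesgue_sums[OF q, of q], of "1 + q"]
        qpoch_inf_shift[OF q2, of "- q"]
      by (simp add: coeff mult_ac del: of_nat_Suc)
    show "summable (\<lambda>j. norm (q ^ tri (int (Suc j)) * (qpoch (- q) q (j + 1) / qpoch q q j)))"
      using summable_mult[OF summable_norm_lebesgue[OF q le_tri_Suc, of "- (q * q)"], of "norm (1 + q)"]
      unfolding norm_mult [symmetric] by (simp add: coeff mult_ac del: of_nat_Suc)
  qed (use n in auto)
  then show ?thesis
    unfolding Z X by (simp add: power3_eq_cube mult_ac)
qed

text \<open>\<open>has_sum\<close> over all pairs expresses unconditional convergence. The third sum
  assumes \<open>q \<noteq> 0\<close> because of \<open>inverse q\<close> and because its exponent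
  is -1 at \<open>i = 1\<close>, \<open>j = 0\<close>; the other exponents are never
  negative.\<close>

theorem theorem5p3:
  fixes q :: complex
  assumes "norm q < 1"
  shows
    "((\<lambda>(i::nat, j::nat).
         q powi (2 * int i ^ 2 - 2 * int i * int j + int j ^ 2 - int i + int j)
           / (qpoch q q (2 * i) * qpoch q q j))
       has_sum (1 / (qpoch_inf q (q ^ 2) ^ 2 * qpoch_inf (q ^ 2) (q ^ 4)))) UNIV
   \<and> ((\<lambda>(i::nat, j::nat).
         q powi (2 * int i ^ 2 - 2 * int i * int j + int j ^ 2 + int i)
           / (qpoch q q (2 * i + 1) * qpoch q q j))
       has_sum (1 / (qpoch_inf q (q ^ 2) ^ 2 * qpoch_inf (q ^ 2) (q ^ 4)))) UNIV
   \<and> (q \<noteq> 0 \<longrightarrow>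
      ((\<lambda>(i::nat, j::nat).
         q powi (2 * int i ^ 2 - 2 * int i * int j + int j ^ 2 - 3 * int i + 2 * int j)
           / (qpoch q q (2 * i) * qpoch q q j))
       has_sum (inverse q * (qpoch_inf (q ^ 2) (q ^ 4) / qpoch_inf q (q ^ 2) ^ 3))) UNIV)
   \<and> ((\<lambda>(i::nat, j::nat).
         q powi (2 * int i ^ 2 - 2 * int i * int j + int j ^ 2 - int i + int j)
           / (qpoch q q (2 * i + 1) * qpoch q q j))
       has_sum (qpoch_inf (q ^ 2) (q ^ 4) / qpoch_inf q (q ^ 2) ^ 3)) UNIV"
proof (intro conjI impI)
  let ?P = "qpoch_inf q (q ^ 2)" and ?Q = "qpoch_inf (q ^ 2) (q ^ 4)"
  \<comment> \<open>Comparing doubled exponents lets \<open>tri_double\<close> replace halves by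
    polynomials.\<close>
  have powi: "q powi k = q ^ e" if "2 * int e = 2 * k" for e k
  proof -
    have "k = int e"
      using that by simp
    then show ?thesis
      by simp
  qed
  have "q powi (2 * int i ^ 2 - 2 * int i * int j + int j ^ 2 - int i + int j)
      = q ^ (tri (int (2 * i) - int j) + tri (int (Suc j)))" for i j
    by (rule powi) (simp only: of_nat_add distrib_left tri_double, simp add: algebra_simps power2_eq_square)
  then show "((\<lambda>(i::nat, j::nat).
         q powi (2 * int i ^ 2 - 2 * int i * int j + int j ^ 2 - int i + int j)
           / (qpoch q q (2 * i) * qpoch q q j))
       has_sum (1 / (?P ^ 2 * ?Q))) UNIV"
    using double_has_sum_0[OF assms, of "\<lambda>i. 2 * i"] by simp
  have "q powi (2 * int i ^ 2 - 2 * int i * int j + int j ^ 2 + int i)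
      = q ^ (tri (int (2 * i + 1) - int j) + tri (int (Suc j)))" for i j
    by (rule powi) (simp only: of_nat_add distrib_left tri_double, simp add: algebra_simps power2_eq_square)
  then show "((\<lambda>(i::nat, j::nat).
         q powi (2 * int i ^ 2 - 2 * int i * int j + int j ^ 2 + int i)
           / (qpoch q q (2 * i + 1) * qpoch q q j))
       has_sum (1 / (?P ^ 2 * ?Q))) UNIV"
    using double_has_sum_0[OF assms, of "\<lambda>i. 2 * i + 1"] by simp
  have "q powi (2 * int i ^ 2 - 2 * int i * int j + int j ^ 2 - int i + int j)
      = q ^ (tri (int (2 * i + 1) - int (Suc j)) + tri (int (Suc j)))" for i j
    by (rule powi) (simp only: of_nat_add distrib_left tri_double, simp add: algebra_simps power2_eq_square)
  then show "((\<lambda>(i::nat, j::nat).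
         q powi (2 * int i ^ 2 - 2 * int i * int j + int j ^ 2 - int i + int j)
           / (qpoch q q (2 * i + 1) * qpoch q q j))
       has_sum (?Q / ?P ^ 3)) UNIV"
    using double_has_sum_1[OF assms, of "\<lambda>i. 2 * i + 1"] by simp
  assume "q \<noteq> 0"
  have shift: "inverse q * q powi (k + 1) = q powi k" for k
    using \<open>q \<noteq> 0\<close> by (simp add: power_int_add_1)
  \<comment> \<open>Adding 1 makes the exponent a sum of two triangular numbers; the factor
    \<open>inverse q\<close> compensates.\<close>
  have exponent: "q powi (2 * int i ^ 2 - 2 * int i * int j + int j ^ 2 - 3 * int i + 2 * int j + 1)
      = q ^ (tri (int (2 * i) - int (Suc j)) + tri (int (Suc j)))" for i j
    by (rule powi) (simp only: of_nat_add distrib_left tri_double, simp add: algebra_simps power2_eq_square)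
  have "q powi (2 * int i ^ 2 - 2 * int i * int j + int j ^ 2 - 3 * int i + 2 * int j)
      = inverse q * q ^ (tri (int (2 * i) - int (Suc j)) + tri (int (Suc j)))" for i j
    by (simp only: exponent [symmetric] shift)
  then show "((\<lambda>(i::nat, j::nat).
         q powi (2 * int i ^ 2 - 2 * int i * int j + int j ^ 2 - 3 * int i + 2 * int j)
           / (qpoch q q (2 * i) * qpoch q q j))
       has_sum (inverse q * (?Q / ?P ^ 3))) UNIV"
    using has_sum_cmult_right[OF double_has_sum_1[OF assms, of "\<lambda>i. 2 * i"], of "inverse q"]
    by (simp add: case_prod_unfold)
qed

end
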